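(* Let $(k,\mathcal B)$ and $(k',\mathcal B')$ be game boards with $|\mathcal B| = |\mathcal B'|=n$, and suppose that $|R| \equiv |R'|\pmod{2}$ for all corresponding Venn regions $R,R'$ of $\mathcal B,\mathcal B'$ (i.e., for every $I\subseteq\{1,\dots,n\}$, including $I=\emptyset$, the Venn regions of $\mathcal B$ and of $\mathcal B'$ corresponding to $I$ have sizes of the same parity). Let $p,t\in\{\mathrm{Split},\mathrm{Skew}\}$. Then Player $p$ has a winning strategy in $(k,\mathcal B,t)$ if and only if $p$ has a winning strategy in $(k',\mathcal B',t)$.
   Context: Let $[k]=\{1,\dots,k\}$. For $A,B\subseteq[k]$, $A$ splits $B$ if $|A\cap B|=|B|/2$ when $|B|$ is even, and $|A\cap B|\in\{(|B|-1)/2,(|B|+1)/2\}$ when $|B|$ is odd; $A$ splits a family if it splits every member. The splitting game: a game board $(k,\mathcal B)$ consists of a positive integer $k$ and a (finite, indexed, repetitions allowed) family $\mathcal B=(B_1,\dots,B_n)$ of subsets of $[k]$. An instance $(k,\mathcal B,t)$ also specifies $t\in\{\mathrm{Split},\mathrm{Skew}\}$, the player who moves first. Players Split and Skew alternately claim an element of $[k]$, without repetition, until all elements are claimed. Split wins if the set of elements Split claimed splits $\mathcal B$; otherwise Skew wins. The Venn region of $\mathcal B$ corresponding to $I\subseteq\{1,\dots,n\}$ is the set of $x\in[k]$ such that $x\in B_i$ for all $i\in I$ and $x\notin B_i$ for all $i\notin I$. *)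

theory Defs
  imports Main
begin

definition splits :: "nat set \<Rightarrow> nat set \<Rightarrow> bool" where
  "splits A B \<longleftrightarrow>
     (if even (card B) then card (A \<inter> B) = card B div 2
      else card (A \<inter> B) \<in> {(card B - 1) div 2, (card B + 1) div 2})"

text \<open>A family \<open>(B\<^sub>1, \<dots>, B\<^sub>n)\<close> is a function \<open>B\<close> of which only the values on \<open>{1..n}\<close> matter.\<close>

definition splits_family :: "nat set \<Rightarrow> nat \<Rightarrow> (nat \<Rightarrow> nat set) \<Rightarrow> bool" where
  "splits_family A n B \<longleftrightarrow> (\<forall>i\<in>{1..n}. splits A (B i))"

definition game_board :: "nat \<Rightarrow> nat \<Rightarrow> (nat \<Rightarrow> nat set) \<Rightarrow> bool" where
  "game_board k n B \<longleftrightarrow> k \<ge> 1 \<and> (\<forall>i\<in>{1..n}. B i \<subseteq> {1..k})"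

definition venn_region :: "nat \<Rightarrow> nat \<Rightarrow> (nat \<Rightarrow> nat set) \<Rightarrow> nat set \<Rightarrow> nat set" where
  "venn_region k n B I =
     {x \<in> {1..k}. (\<forall>i\<in>I. x \<in> B i) \<and> (\<forall>i\<in>{1..n} - I. x \<notin> B i)}"

datatype player = Split | Skew

fun opponent :: "player \<Rightarrow> player" where
  "opponent Split = Skew"
| "opponent Skew = Split"

text \<open>\<open>mover t j\<close> is the player who makes the move number \<open>j\<close> (counted from \<open>0\<close>)
  when \<open>t\<close> moves first.\<close>

definition mover :: "player \<Rightarrow> nat \<Rightarrow> player" where
  "mover t j = (if even j then t else opponent t)"

text \<open>A position is recorded as its history: the list of the elements claimed so far,
  in the order in which they were claimed.\<close>

definition history :: "nat \<Rightarrow> nat list \<Rightarrow> bool" where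
  "history k h \<longleftrightarrow> distinct h \<and> set h \<subseteq> {1..k}"

definition complete_play :: "nat \<Rightarrow> nat list \<Rightarrow> bool" where
  "complete_play k h \<longleftrightarrow> distinct h \<and> set h = {1..k}"

definition claimed :: "player \<Rightarrow> player \<Rightarrow> nat list \<Rightarrow> nat set" where
  "claimed p t h = {h ! j | j. j < length h \<and> mover t j = p}"

definition winner :: "nat \<Rightarrow> (nat \<Rightarrow> nat set) \<Rightarrow> player \<Rightarrow> nat list \<Rightarrow> player" where
  "winner n B t h = (if splits_family (claimed Split t h) n B then Split else Skew)"

text \<open>A strategy has to supply a legal move in every position in which its player is to move;
  without this, a strategy with no consistent complete play would be vacuously winning.\<close>

definition strategy :: "player \<Rightarrow> nat \<Rightarrow> player \<Rightarrow> (nat list \<Rightarrow> nat) \<Rightarrow> bool" where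
  "strategy p k t \<sigma> \<longleftrightarrow>
     (\<forall>h. history k h \<and> length h < k \<and> mover t (length h) = p \<longrightarrow> \<sigma> h \<in> {1..k} - set h)"

definition consistent :: "player \<Rightarrow> player \<Rightarrow> (nat list \<Rightarrow> nat) \<Rightarrow> nat list \<Rightarrow> bool" where
  "consistent p t \<sigma> h \<longleftrightarrow> (\<forall>j<length h. mover t j = p \<longrightarrow> h ! j = \<sigma> (take j h))"

definition has_winning_strategy ::
  "player \<Rightarrow> nat \<Rightarrow> nat \<Rightarrow> (nat \<Rightarrow> nat set) \<Rightarrow> player \<Rightarrow> bool" where
  "has_winning_strategy p k n B t \<longleftrightarrow>
     (\<exists>\<sigma>. strategy p k t \<sigma> \<and>
        (\<forall>h. complete_play k h \<and> consistent p t \<sigma> h \<longrightarrow> winner n B t h = p))"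

end

theory Submission
  imports Defs "HOL-Library.Multiset" "HOL-Library.Function_Algebras"
begin

text \<open>
  Two elements of the same Venn region cancel. Suppose such a pair is added to a position. If a
  player takes one element of the pair, the other player can take the second one and is back in
  the position without the pair, with the same player to move; so neither player gains anything
  from the pair, and when only the pair is left each player gets one element of it. Whether a set
  of the family is split depends only on the difference between the numbers of its elements
  claimed by the two players, and a pair that is shared does not change that difference. Hence
  only the parities of the region sizes matter.

  To make this a short induction, elements are replaced by their Venn regions: a position becomes
  the multiset of the regions of the unclaimed elements, together with the vector of the differences
  obtained so far. In this game of multisets, which is solved by backward induction, the
  cancellation of a pair is \<open>split_wins_add_pair\<close>, and \<open>split_wins_cong_parity\<close> is the theorem
  in its abstract form; two boards with the same parities can be compared there directly, since
  their tokens have the same names. What remains is the translation: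
  \<open>has_winning_strategy_iff_value\<close> says that a winning strategy exists exactly if backward
  induction assigns the empty history to the player, and
  \<open>has_winning_strategy_iff_split_wins\<close> identifies the outcome of backward induction on histories
  with that of the multiset game.
\<close>

section \<open>A game of claiming weighted tokens\<close>

text \<open>
  The tokens in \<open>M\<close> are claimed alternately; a token \<open>a\<close> moves the balance \<open>d\<close> by \<open>w a\<close> if Split
  takes it and by \<open>- w a\<close> if Skew does. Split aims at a final balance with \<open>P\<close>,
  and the value says whether optimal play achieves this.
\<close>

function split_wins ::
  "('a \<Rightarrow> 'v::ab_group_add) \<Rightarrow> ('v \<Rightarrow> bool) \<Rightarrow> player \<Rightarrow> 'a multiset \<Rightarrow> 'v \<Rightarrow> bool" where
  "split_wins w P t M d =
     (if M = {#} then P d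
      else case t of
        Split \<Rightarrow> \<exists>a\<in>set_mset M. split_wins w P Skew (M - {#a#}) (d + w a)
      | Skew \<Rightarrow> \<forall>a\<in>set_mset M. split_wins w P Split (M - {#a#}) (d - w a))"
  by pat_completeness auto
termination
  by (relation "measure (\<lambda>(w, P, t, M, d). size M)") (auto simp: size_Diff1_less)

declare split_wins.simps [simp del]

lemma split_wins_empty [simp]: "split_wins w P t {#} d = P d"
  by (simp add: split_wins.simps)

lemma split_wins_Split:
  "M \<noteq> {#} \<Longrightarrow>
    split_wins w P Split M d \<longleftrightarrow> (\<exists>a\<in>#M. split_wins w P Skew (M - {#a#}) (d + w a))"
  by (subst split_wins.simps) simp

lemma split_wins_Skew:
  "M \<noteq> {#} \<Longrightarrow>
    split_wins w P Skew M d \<longleftrightarrow> (\<forall>a\<in>#M. split_wins w P Split (M - {#a#}) (d - w a))"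
  by (subst split_wins.simps) simp

text \<open>
  Whatever good move exists without the pair stays good with it, by induction. Conversely, a move
  into the pair is answered inside the pair, which restores the balance and the mover. Since this
  is an equivalence of values, it settles at once whether either player can win.
\<close>

lemma split_wins_add_pair:
  "split_wins w P t (add_mset a (add_mset a M)) d \<longleftrightarrow> split_wins w P t M d"
proof (induction "size M" arbitrary: M t d rule: less_induct)
  case less
  let ?M2 = "add_mset a (add_mset a M)"
  have IH: "split_wins w P s (?M2 - {#b#}) e \<longleftrightarrow> split_wins w P s (M - {#b#}) e"
    if "b \<in># M" for b s e
  proof -
    have "?M2 - {#b#} = add_mset a (add_mset a (M - {#b#}))"
      using that by simp
    then show ?thesis
      using less[of "M - {#b#}" s e] that by (simp add: size_Diff1_less)
  qed
  show ?case
  proof (cases t)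
    case Split
    have "split_wins w P Skew (add_mset a M) (d + w a) \<longrightarrow> split_wins w P Split M d"
      by (subst split_wins_Skew) auto
    moreover have "split_wins w P Skew (add_mset a {#}) (d + w a) \<longleftrightarrow> P d"
      by (simp add: split_wins_Skew)
    ultimately show ?thesis
      using IH by (cases "M = {#}") (auto simp: Split split_wins_Split)
  next
    case Skew
    have "split_wins w P Skew M d \<longrightarrow> split_wins w P Split (add_mset a M) (d - w a)"
      by (subst split_wins_Split) auto
    moreover have "split_wins w P Split (add_mset a {#}) (d - w a) \<longleftrightarrow> P d"
      by (simp add: split_wins_Split)
    ultimately show ?thesis
      using IH by (cases "M = {#}") (auto simp: Skew split_wins_Skew)
  qed
qed

lemma split_wins_add_even:
  assumes "\<And>a. even (count K a)"
  shows "split_wins w P t (M + K) d \<longleftrightarrow> split_wins w P t M d"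
  using assms
proof (induction "size K" arbitrary: K rule: less_induct)
  case less
  show ?case
  proof (cases K)
    case (add a K1)
    have "a \<in># K1"
      using less.prems[of a] add by (auto intro: ccontr simp: not_in_iff)
    then obtain K2 where K1: "K1 = add_mset a K2"
      by (metis multi_member_split)
    have "even (count K2 b)" for b
      using less.prems[of b] add K1 by (auto split: if_splits)
    then have "split_wins w P t (M + K2) d \<longleftrightarrow> split_wins w P t M d"
      using less.hyps[of K2] add K1 by simp
    then show ?thesis
      using split_wins_add_pair[of w P t a "M + K2" d] add K1 by simp
  qed simp
qed

text \<open>
  The multiset \<open>M + (N + N) = N + (M + N)\<close> arises from \<open>M\<close> as well as from \<open>N\<close> by adding tokens
  with even multiplicities.
\<close>

lemma split_wins_cong_parity:
  assumes "\<And>a. count M a mod 2 = count N a mod 2"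
  shows "split_wins w P t M d \<longleftrightarrow> split_wins w P t N d"
proof -
  have "even (count (M + N) a)" for a
    using assms[of a] unfolding count_union by presburger
  then have "split_wins w P t (N + (M + N)) d \<longleftrightarrow> split_wins w P t N d"
    by (rule split_wins_add_even)
  moreover have "split_wins w P t (M + (N + N)) d \<longleftrightarrow> split_wins w P t M d"
    by (rule split_wins_add_even) simp
  ultimately show ?thesis
    by (simp add: ac_simps)
qed

section \<open>Winning strategies and backward induction\<close>

lemma history_snoc:
  "history k (h @ [x]) \<longleftrightarrow> history k h \<and> x \<in> {1..k} - set h"
  by (auto simp: history_def)

lemma history_length_le: "history k h \<Longrightarrow> length h \<le> k"
  unfolding history_def
  by (metis card_atLeastAtMost card_mono diff_Suc_1 distinct_card finite_atLeastAtMost)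

lemma complete_play_iff: "complete_play k h \<longleftrightarrow> history k h \<and> length h = k"
proof
  assume "complete_play k h"
  then show "history k h \<and> length h = k"
    unfolding complete_play_def history_def
    by (metis card_atLeastAtMost diff_Suc_1 distinct_card order_refl)
next
  assume "history k h \<and> length h = k"
  then show "complete_play k h"
    unfolding complete_play_def history_def
    by (metis card_atLeastAtMost card_subset_eq diff_Suc_1 distinct_card finite_atLeastAtMost)
qed

lemma consistent_snoc:
  "consistent p t \<sigma> (h @ [x]) \<longleftrightarrow>
     consistent p t \<sigma> h \<and> (mover t (length h) = p \<longrightarrow> x = \<sigma> h)"
  by (auto simp: consistent_def nth_append less_Suc_eq)

text \<open>
  A predicate \<open>V\<close> on histories that obeys the rules of backward induction for \<open>p\<close> decides the game.
  If \<open>V\<close> holds at the start, \<open>p\<close> wins by always moving to a position where \<open>V\<close> holds. Conversely,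
  from the complete plays backwards, \<open>V\<close> holds at every position that a winning strategy of \<open>p\<close>
  allows.
\<close>

lemma has_winning_strategy_iff_value:
  assumes final: "\<And>h. complete_play k h \<Longrightarrow> V h \<longleftrightarrow> winner n B t h = p"
    and own: "\<And>h. \<lbrakk>history k h; length h < k; mover t (length h) = p\<rbrakk> \<Longrightarrow>
        V h \<longleftrightarrow> (\<exists>x\<in>{1..k} - set h. V (h @ [x]))"
    and other: "\<And>h. \<lbrakk>history k h; length h < k; mover t (length h) \<noteq> p\<rbrakk> \<Longrightarrow>
        V h \<longleftrightarrow> (\<forall>x\<in>{1..k} - set h. V (h @ [x]))"
  shows "has_winning_strategy p k n B t \<longleftrightarrow> V []"
proof
  assume "has_winning_strategy p k n B t"
  then obtain \<sigma> where strat: "strategy p k t \<sigma>"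
    and win: "\<And>h. \<lbrakk>complete_play k h; consistent p t \<sigma> h\<rbrakk> \<Longrightarrow> winner n B t h = p"
    unfolding has_winning_strategy_def by blast
  have "V h" if "history k h" "consistent p t \<sigma> h" for h
    using that
  proof (induction "k - length h" arbitrary: h rule: less_induct)
    case less
    show ?case
    proof (cases "length h = k")
      case True
      then show ?thesis
        using final win less.prems by (simp add: complete_play_iff)
    next
      case False
      then have short: "length h < k"
        using history_length_le[OF less.prems(1)] by simp
      have step: "V (h @ [x])"
        if "x \<in> {1..k} - set h" "mover t (length h) = p \<longrightarrow> x = \<sigma> h" for x
        using less.hyps[of "h @ [x]"] less.prems that short
        by (auto simp: history_snoc consistent_snoc)
      show ?thesis
      proof (cases "mover t (length h) = p")
        case True
        then have "\<sigma> h \<in> {1..k} - set h"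
          using strat less.prems(1) short unfolding strategy_def by blast
        then show ?thesis
          using own[OF less.prems(1) short True] step by blast
      next
        case False
        then show ?thesis
          using other[OF less.prems(1) short False] step by blast
      qed
    qed
  qed
  then show "V []"
    by (simp add: history_def consistent_def)
next
  assume start: "V []"
  \<comment> \<open>A strategy must move legally also in lost positions, so the choice asks for \<open>V\<close> only
    where it can be had.\<close>
  define \<sigma> where "\<sigma> h = (SOME x. x \<in> {1..k} - set h \<and>
      ((\<exists>y\<in>{1..k} - set h. V (h @ [y])) \<longrightarrow> V (h @ [x])))" for h
  have \<sigma>: "\<sigma> h \<in> {1..k} - set h \<and>
      ((\<exists>y\<in>{1..k} - set h. V (h @ [y])) \<longrightarrow> V (h @ [\<sigma> h]))"
    if h: "history k h" "length h < k" for h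
  proof -
    have "set h \<noteq> {1..k}"
      using h complete_play_iff[of k h] by (auto simp: complete_play_def history_def)
    then have "{1..k} - set h \<noteq> {}"
      using h(1) by (auto simp: history_def)
    then have "\<exists>x. x \<in> {1..k} - set h \<and>
        ((\<exists>y\<in>{1..k} - set h. V (h @ [y])) \<longrightarrow> V (h @ [x]))"
      by blast
    from someI_ex[OF this] show ?thesis
      unfolding \<sigma>_def .
  qed
  have "strategy p k t \<sigma>"
    using \<sigma> unfolding strategy_def by blast
  moreover have "V h" if "history k h" "consistent p t \<sigma> h" for h
    using that
  proof (induction h rule: rev_induct)
    case Nil
    then show ?case using start by simp
  next
    case (snoc x h)
    have h: "history k h" "x \<in> {1..k} - set h" "V h"
      using snoc by (auto simp: history_snoc consistent_snoc)
    have short: "length h < k"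
      using history_length_le[OF snoc.prems(1)] by simp
    show ?case
    proof (cases "mover t (length h) = p")
      case True
      then show ?thesis
        using own[OF h(1) short True] \<sigma>[OF h(1) short] h snoc.prems by (auto simp: consistent_snoc)
    next
      case False
      then show ?thesis
        using other[OF h(1) short False] h by blast
    qed
  qed
  ultimately show "has_winning_strategy p k n B t"
    unfolding has_winning_strategy_def using final by (auto simp: complete_play_iff)
qed

section \<open>From histories to multisets of Venn regions\<close>

lemma claimed_Nil [simp]: "claimed p t [] = {}"
  by (simp add: claimed_def)

lemma claimed_snoc:
  "claimed p t (h @ [x]) =
    (if mover t (length h) = p then insert x (claimed p t h) else claimed p t h)"
proof -
  have "{j. j < length (h @ [x]) \<and> mover t j = p} =
      {j. j < length h \<and> mover t j = p} \<union> {j. j = length h \<and> mover t j = p}"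
    by auto
  moreover have "(!) (h @ [x]) ` {j. j < length h \<and> mover t j = p} =
      (!) h ` {j. j < length h \<and> mover t j = p}"
    by (rule image_cong) (simp_all add: nth_append)
  moreover have "(!) (h @ [x]) ` {j. j = length h \<and> mover t j = p} =
      (if mover t (length h) = p then {x} else {})"
    by auto
  ultimately show ?thesis
    unfolding claimed_def setcompr_eq_image by (simp only: image_Un) simp
qed

lemma claimed_subset: "claimed p t h \<subseteq> set h"
  by (auto simp: claimed_def)

lemma finite_claimed [simp]: "finite (claimed p t h)"
  by (rule finite_subset[OF claimed_subset]) simp

lemma claimed_Un: "claimed Split t h \<union> claimed Skew t h = set h"
proof
  show "set h \<subseteq> claimed Split t h \<union> claimed Skew t h"
  proof
    fix x assume "x \<in> set h"
    then obtain j where "j < length h" "x = h ! j"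
      by (auto simp: in_set_conv_nth)
    then show "x \<in> claimed Split t h \<union> claimed Skew t h"
      by (cases "mover t j") (auto simp: claimed_def)
  qed
qed (simp add: claimed_subset)

lemma claimed_disjoint: "distinct h \<Longrightarrow> claimed Split t h \<inter> claimed Skew t h = {}"
  by (auto simp: claimed_def nth_eq_iff_index_eq)

lemma mover_Suc: "mover t (Suc j) = opponent (mover t j)"
  by (cases t) (simp_all add: mover_def)

text \<open>
  The two parts of \<open>B\<close> have sizes that add up to \<open>card B\<close>, so their difference has the parity of
  \<open>card B\<close>; splitting means that this difference is as small as its parity permits.
\<close>

lemma splits_iff_balance:
  assumes "finite A" "finite C" "A \<inter> C = {}" "B \<subseteq> A \<union> C"
  shows "splits A B \<longleftrightarrow> \<bar>int (card (A \<inter> B)) - int (card (C \<inter> B))\<bar> \<le> 1"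
proof -
  have "B = (A \<inter> B) \<union> (C \<inter> B)" "(A \<inter> B) \<inter> (C \<inter> B) = {}"
    using assms by auto
  then have card_B: "card B = card (A \<inter> B) + card (C \<inter> B)"
    using assms by (metis card_Un_disjoint finite_Int)
  show ?thesis
  proof (cases "even (card B)")
    case True
    then obtain m where m: "card B = 2 * m" ..
    then have "splits A B \<longleftrightarrow> card (A \<inter> B) = m"
      by (simp add: splits_def)
    then show ?thesis
      using card_B m by linarith
  next
    case False
    then obtain m where m: "card B = 2 * m + 1" ..
    then have "splits A B \<longleftrightarrow> card (A \<inter> B) = m \<or> card (A \<inter> B) = m + 1"
      by (simp add: splits_def)
    then show ?thesis
      using card_B m by linarith
  qed
qed

definition region_index :: "nat \<Rightarrow> (nat \<Rightarrow> nat set) \<Rightarrow> nat \<Rightarrow> nat set" where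
  "region_index n B x = {i \<in> {1..n}. x \<in> B i}"

definition index_weight :: "nat set \<Rightarrow> nat \<Rightarrow> int" where
  "index_weight I i = of_bool (i \<in> I)"

definition balanced :: "nat \<Rightarrow> (nat \<Rightarrow> int) \<Rightarrow> bool" where
  "balanced n d \<longleftrightarrow> (\<forall>i\<in>{1..n}. \<bar>d i\<bar> \<le> 1)"

definition region_mset :: "nat \<Rightarrow> (nat \<Rightarrow> nat set) \<Rightarrow> nat set \<Rightarrow> nat set multiset" where
  "region_mset n B S = image_mset (region_index n B) (mset_set S)"

text \<open>
  Being a sum of region weights, the balance of a history changes with a move just as in the token
  game; its value at \<open>i\<close> is the difference that decides whether \<open>B i\<close> is split.
\<close>

definition history_balance :: "nat \<Rightarrow> (nat \<Rightarrow> nat set) \<Rightarrow> player \<Rightarrow> nat list \<Rightarrow> nat \<Rightarrow> int" where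
  "history_balance n B t h =
     (\<Sum>x\<in>claimed Split t h. index_weight (region_index n B x))
     - (\<Sum>x\<in>claimed Skew t h. index_weight (region_index n B x))"

lemma sum_index_weight_apply:
  assumes "finite A" "i \<in> {1..n}"
  shows "(\<Sum>x\<in>A. index_weight (region_index n B x)) i = int (card (A \<inter> B i))"
  using assms
  by (induction A rule: finite_induct) (auto simp: index_weight_def region_index_def)

lemma history_balance_snoc:
  assumes "x \<notin> set h"
  shows "history_balance n B t (h @ [x]) =
    (case mover t (length h) of
       Split \<Rightarrow> history_balance n B t h + index_weight (region_index n B x)
     | Skew \<Rightarrow> history_balance n B t h - index_weight (region_index n B x))"
proof -
  have "x \<notin> claimed q t h" for q
    using assms claimed_subset by blast
  then show ?thesis
    by (cases "mover t (length h)")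
      (simp_all add: history_balance_def claimed_snoc algebra_simps)
qed

lemma balanced_history_balance_iff:
  assumes "game_board k n B" "complete_play k h"
  shows "balanced n (history_balance n B t h) \<longleftrightarrow> splits_family (claimed Split t h) n B"
proof -
  have "splits (claimed Split t h) (B i) \<longleftrightarrow> \<bar>history_balance n B t h i\<bar> \<le> 1"
    if i: "i \<in> {1..n}" for i
  proof -
    have "B i \<subseteq> claimed Split t h \<union> claimed Skew t h"
      using assms i by (simp add: claimed_Un game_board_def complete_play_def)
    moreover have "claimed Split t h \<inter> claimed Skew t h = {}"
      using assms by (simp add: claimed_disjoint complete_play_def)
    ultimately show ?thesis
      using i by (simp add: splits_iff_balance history_balance_def sum_index_weight_apply)
  qed
  then show ?thesis
    by (simp add: balanced_def splits_family_def)
qed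

lemma region_mset_remove:
  assumes "finite S" "x \<in> S"
  shows "region_mset n B (S - {x}) = region_mset n B S - {#region_index n B x#}"
  using assms by (simp add: region_mset_def mset_set_Diff image_mset_Diff)

lemma count_region_mset:
  "count (region_mset n B {1..k}) I =
     (if I \<subseteq> {1..n} then card (venn_region k n B I) else 0)"
proof -
  have "count (region_mset n B {1..k}) I = card {x \<in> {1..k}. region_index n B x = I}"
    by (simp add: region_mset_def count_image_mset' sum.If_cases Int_def eq_commute[of I] flip: sum.inter_filter)
  moreover have "{x \<in> {1..k}. region_index n B x = I} =
      (if I \<subseteq> {1..n} then venn_region k n B I else {})"
    by (auto simp: region_index_def venn_region_def)
  ultimately show ?thesis by simp
qed

text \<open>
  Claiming an element with region \<open>I\<close> is claiming a token \<open>I\<close>, so the outcome of the token game,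
  read along histories, satisfies the rules of backward induction. The equation with \<open>p = Split\<close>
  turns Split's outcome into that of \<open>p\<close>.
\<close>

lemma has_winning_strategy_iff_split_wins:
  assumes board: "game_board k n B"
  shows "has_winning_strategy p k n B t \<longleftrightarrow>
    (split_wins index_weight (balanced n) t (region_mset n B {1..k}) 0 \<longleftrightarrow> p = Split)"
proof -
  define W where "W h = split_wins index_weight (balanced n) (mover t (length h))
      (region_mset n B ({1..k} - set h)) (history_balance n B t h)" for h
  have final: "(W h \<longleftrightarrow> p = Split) \<longleftrightarrow> winner n B t h = p" if h: "complete_play k h" for h
  proof -
    have "W h \<longleftrightarrow> splits_family (claimed Split t h) n B"
      using h balanced_history_balance_iff[OF board h]
      by (simp add: W_def region_mset_def complete_play_def)
    then show ?thesis
      by (cases p) (auto simp: winner_def)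
  qed
  have step: "W h \<longleftrightarrow> (case mover t (length h) of
        Split \<Rightarrow> \<exists>x\<in>{1..k} - set h. W (h @ [x])
      | Skew \<Rightarrow> \<forall>x\<in>{1..k} - set h. W (h @ [x]))"
    if h: "history k h" "length h < k" for h
  proof -
    let ?R = "{1..k} - set h"
    let ?M = "region_mset n B ?R"
    have "set h \<noteq> {1..k}"
      using h complete_play_iff[of k h] by (auto simp: complete_play_def history_def)
    then have "?R \<noteq> {}"
      using h(1) by (auto simp: history_def)
    then have ne: "?M \<noteq> {#}"
      by (simp add: region_mset_def mset_set_empty_iff)
    have elems: "set_mset ?M = region_index n B ` ?R"
      by (simp add: region_mset_def)
    have Diff: "{1..k} - set (h @ [x]) = ?R - {x}" for x
      by auto
    have move: "W (h @ [x]) \<longleftrightarrow> (case mover t (length h) of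
        Split \<Rightarrow> split_wins index_weight (balanced n) Skew (?M - {#region_index n B x#})
          (history_balance n B t h + index_weight (region_index n B x))
      | Skew \<Rightarrow> split_wins index_weight (balanced n) Split (?M - {#region_index n B x#})
          (history_balance n B t h - index_weight (region_index n B x)))"
      if x: "x \<in> ?R" for x
      using x unfolding W_def Diff
      by (cases "mover t (length h)")
        (simp_all add: mover_Suc history_balance_snoc region_mset_remove)
    show ?thesis
      using move
      by (cases "mover t (length h)")
        (simp_all add: W_def[of h] split_wins_Split[OF ne] split_wins_Skew[OF ne] elems
          del: One_nat_def)
  qed
  have "has_winning_strategy p k n B t \<longleftrightarrow> (W [] \<longleftrightarrow> p = Split)"
  proof (rule has_winning_strategy_iff_value[where V = "\<lambda>h. W h \<longleftrightarrow> p = Split"])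
    fix h assume h: "history k h" "length h < k"
    show "(W h \<longleftrightarrow> p = Split) \<longleftrightarrow> (\<exists>x\<in>{1..k} - set h. W (h @ [x]) \<longleftrightarrow> p = Split)"
      if "mover t (length h) = p"
      using step[OF h] that by (cases p) auto
    show "(W h \<longleftrightarrow> p = Split) \<longleftrightarrow> (\<forall>x\<in>{1..k} - set h. W (h @ [x]) \<longleftrightarrow> p = Split)"
      if "mover t (length h) \<noteq> p"
      using step[OF h] that by (cases p; cases "mover t (length h)") auto
  qed (rule final)
  moreover have "W [] \<longleftrightarrow> split_wins index_weight (balanced n) t (region_mset n B {1..k}) 0"
    by (simp add: W_def mover_def history_balance_def)
  ultimately show ?thesis by simp
qed

theorem lemma5p1:
  fixes k k' n :: nat and B B' :: "nat \<Rightarrow> nat set" and p t :: player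
  assumes "game_board k n B"
    and "game_board k' n B'"
    and "\<And>I. I \<subseteq> {1..n} \<Longrightarrow>
           card (venn_region k n B I) mod 2 = card (venn_region k' n B' I) mod 2"
  shows "has_winning_strategy p k n B t \<longleftrightarrow> has_winning_strategy p k' n B' t"
proof -
  have "count (region_mset n B {1..k}) I mod 2 = count (region_mset n B' {1..k'}) I mod 2" for I
    using assms(3)[of I] by (simp only: count_region_mset split: if_split) blast
  then have "split_wins index_weight (balanced n) t (region_mset n B {1..k}) 0 \<longleftrightarrow>
      split_wins index_weight (balanced n) t (region_mset n B' {1..k'}) 0"
    by (rule split_wins_cong_parity)
  then show ?thesis
    using assms(1,2) by (simp only: has_winning_strategy_iff_split_wins)
qed

end
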